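(* Let $X$ be a metric space, $I$ a countable set, $\omega$ an ultrafilter over $I$ and $\mu=(\mu_n)_{n\in I}$ a sequence of ultrafilters over $I$. For every $n\in I$ let $e^{(n)}=(e^{(n)}_k)_{k\in I}$ be an observation point and $d^{(n)}=(d^{(n)}_k)_{k\in I}$ a sequence of scaling constants satisfying $\lim_{\mu_n}d^{(n)}_k=\infty$, and let $\mathrm{Con}^{\mu_n}(X;e^{(n)},d^{(n)})$ be the corresponding asymptotic cone of $X$. Put $e=(e^{(n)}_k)_{(n,k)\in I\times I}$ and $d=(d^{(n)}_k)_{(n,k)\in I\times I}$. Then the map $$\lim\nolimits^{\omega\mu}\big(x^{(n)}_k\big)\mapsto\lim\nolimits^{\omega}\Big(\lim\nolimits^{\mu_n}\big(x^{(n)}_k\big)\Big)$$ is an isometry from $\mathrm{Con}^{\omega\mu}(X;e,d)$ onto $$\lim\nolimits^\omega\Big(\mathrm{Con}^{\mu_n}\big(X;e^{(n)},d^{(n)}\big)\Big)_{(\lim^{\mu_n}(e^{(n)}))_{n\in I}}.$$ In particular, this $\omega$-limit of asymptotic cones of $X$ is an asymptotic cone of $X$.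
   Context: All ultrafilters are non-principal (no finite set belongs to them), over countable sets, and are viewed as $\{0,1\}$-valued finitely additive measures. The ultrafilter $\omega\mu$ over $I\times I$ is defined by: for $A\subseteq I\times I$, $\omega\mu(A)$ is the $\omega$-measure of the set of all $n\in I$ such that $\mu_n(\{k\in I\mid (n,k)\in A\})=1$. For metric spaces $(X_n,\mathrm{dist}_n)_{n\in I}$, an ultrafilter $\omega$ over $I$ and an observation point $e=(e_n)$, $e_n\in X_n$, the $\omega$-limit $\lim^\omega(X_n)_e$ is the metric space of sequences $(x_n)$, $x_n\in X_n$, with $\lim_\omega\mathrm{dist}_n(x_n,e_n)<\infty$, with pseudo-distance $\lim_\omega\mathrm{dist}_n(x_n,y_n)$, modulo the relation of being at pseudo-distance $0$; the class of $(x_n)$ is $\lim^\omega(x_n)$. If $d=(d_n)$ are positive numbers with $\lim_\omega d_n=\infty$, then $\mathrm{Con}^\omega(X;e,d)=\lim^\omega(X,\mathrm{dist}/d_n)_e$. (For $\lim^{\omega\mu}$ the index set is $I\times I$.) *)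

theory Defs
  imports "HOL-Analysis.Analysis"
begin

section \<open>Ultrafilters\<close>

text \<open>
  A \<open>{0,1}\<close>-valued finitely additive measure \<open>\<omega>\<close> on a set \<open>I\<close> is represented by the filter of its
  sets of measure 1: \<open>\<omega>(A) = 1\<close> is \<open>\<forall>\<^sub>F n in \<omega>. n \<in> A\<close>. The index set is a subset of a type,
  and \<open>\<omega> \<le> principal I\<close> says that \<open>\<omega>\<close> lives on \<open>I\<close>.
\<close>

definition ultrafilter_over :: "'i set \<Rightarrow> 'i filter \<Rightarrow> bool" where
  "ultrafilter_over I \<omega> \<longleftrightarrow>
     \<omega> \<le> principal I \<and> \<omega> \<noteq> bot \<and>
     (\<forall>A\<subseteq>I. (\<forall>\<^sub>F n in \<omega>. n \<in> A) \<or> (\<forall>\<^sub>F n in \<omega>. n \<in> I - A)) \<and>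
     (\<forall>A. finite A \<longrightarrow> \<not> (\<forall>\<^sub>F n in \<omega>. n \<in> A))"

definition prod_ultrafilter :: "'i filter \<Rightarrow> ('i \<Rightarrow> 'j filter) \<Rightarrow> ('i \<times> 'j) filter" where
  "prod_ultrafilter \<omega> \<mu> = Abs_filter (\<lambda>P. \<forall>\<^sub>F n in \<omega>. \<forall>\<^sub>F k in \<mu> n. P (n, k))"

lemma eventually_prod_ultrafilter:
  fixes \<omega> :: "'i filter" and \<mu> :: "'i \<Rightarrow> 'j filter"
  shows "eventually P (prod_ultrafilter \<omega> \<mu>) \<longleftrightarrow> (\<forall>\<^sub>F n in \<omega>. \<forall>\<^sub>F k in \<mu> n. P (n, k))"
  unfolding prod_ultrafilter_def
proof (rule eventually_Abs_filter, unfold_locales)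
  fix P Q :: "'i \<times> 'j \<Rightarrow> bool"
  show "\<forall>\<^sub>F n in \<omega>. \<forall>\<^sub>F k in \<mu> n. P (n, k) \<and> Q (n, k)"
    if "\<forall>\<^sub>F n in \<omega>. \<forall>\<^sub>F k in \<mu> n. P (n, k)" "\<forall>\<^sub>F n in \<omega>. \<forall>\<^sub>F k in \<mu> n. Q (n, k)"
    using that by (simp add: eventually_conj_iff)
  show "\<forall>\<^sub>F n in \<omega>. \<forall>\<^sub>F k in \<mu> n. Q (n, k)"
    if "\<forall>x. P x \<longrightarrow> Q x" "\<forall>\<^sub>F n in \<omega>. \<forall>\<^sub>F k in \<mu> n. P (n, k)"
    using that(2) by (rule eventually_mono) (use that(1) in \<open>auto elim: eventually_mono\<close>)
qed simp

lemma ultrafilter_over_nontrivial: "ultrafilter_over I \<omega> \<Longrightarrow> \<omega> \<noteq> bot"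
  unfolding ultrafilter_over_def by (elim conjE)

lemma ultrafilter_over_index: "ultrafilter_over I \<omega> \<Longrightarrow> \<forall>\<^sub>F n in \<omega>. n \<in> I"
  unfolding ultrafilter_over_def le_principal by (elim conjE)

lemma ultrafilter_over_dichotomy:
  assumes "ultrafilter_over I \<omega>"
  shows "eventually P \<omega> \<or> (\<forall>\<^sub>F n in \<omega>. \<not> P n)"
proof -
  have "\<forall>A\<subseteq>I. (\<forall>\<^sub>F n in \<omega>. n \<in> A) \<or> (\<forall>\<^sub>F n in \<omega>. n \<in> I - A)"
    using assms unfolding ultrafilter_over_def by (elim conjE)
  then have "(\<forall>\<^sub>F n in \<omega>. n \<in> {n \<in> I. P n}) \<or> (\<forall>\<^sub>F n in \<omega>. n \<in> I - {n \<in> I. P n})"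
    by (rule allE[of _ "{n \<in> I. P n}"]) simp
  then show ?thesis
  proof
    assume "\<forall>\<^sub>F n in \<omega>. n \<in> {n \<in> I. P n}"
    then show ?thesis by (intro disjI1) (simp add: eventually_conj_iff)
  next
    assume "\<forall>\<^sub>F n in \<omega>. n \<in> I - {n \<in> I. P n}"
    then have "\<forall>\<^sub>F n in \<omega>. \<not> P n" by (rule eventually_mono) simp
    then show ?thesis ..
  qed
qed

lemma ultrafilter_over_tendsto:
  fixes f :: "'i \<Rightarrow> 'b::topological_space"
  assumes \<omega>: "ultrafilter_over I \<omega>" and "compact (UNIV :: 'b set)"
  shows "\<exists>l. (f \<longlongrightarrow> l) \<omega>"
proof -
  have "filtermap f \<omega> \<noteq> bot"
    using ultrafilter_over_nontrivial[OF \<omega>] by (simp add: filtermap_bot_iff)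
  then obtain l where l: "inf (nhds l) (filtermap f \<omega>) \<noteq> bot"
    using assms(2) unfolding compact_filter by auto
  have "(f \<longlongrightarrow> l) \<omega>"
  proof (rule topological_tendstoI)
    fix S assume S: "open S" "l \<in> S"
    show "\<forall>\<^sub>F n in \<omega>. f n \<in> S"
    proof (rule ccontr)
      assume "\<not> ?thesis"
      then have "\<forall>\<^sub>F y in filtermap f \<omega>. y \<notin> S"
        using ultrafilter_over_dichotomy[OF \<omega>, of "\<lambda>n. f n \<in> S"] by (simp add: eventually_filtermap)
      moreover have "\<forall>\<^sub>F y in nhds l. y \<in> S"
        using S by (rule eventually_nhds_in_open)
      ultimately have "eventually (\<lambda>_. False) (inf (nhds l) (filtermap f \<omega>))"
        unfolding eventually_inf by blast
      with l show False
        by (simp add: trivial_limit_def)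
    qed
  qed
  then show ?thesis ..
qed


section \<open>Ultralimits of metric spaces\<close>

text \<open>
  The limit is taken in the extended reals, where it always exists along an ultrafilter; so the
  finiteness condition on sequences is really a comparison with infinity.
\<close>

definition ulim_dist :: "'i filter \<Rightarrow> ('i \<Rightarrow> 'a metric) \<Rightarrow> ('i \<Rightarrow> 'a) \<Rightarrow> ('i \<Rightarrow> 'a) \<Rightarrow> ereal" where
  "ulim_dist \<omega> X x y = Lim \<omega> (\<lambda>n. ereal (mdist (X n) (x n) (y n)))"

definition ulim_seqs ::
  "'i set \<Rightarrow> 'i filter \<Rightarrow> ('i \<Rightarrow> 'a metric) \<Rightarrow> ('i \<Rightarrow> 'a) \<Rightarrow> ('i \<Rightarrow> 'a) set" where
  "ulim_seqs I \<omega> X e = {x \<in> \<Pi>\<^sub>E n\<in>I. mspace (X n). ulim_dist \<omega> X x e < \<infinity>}"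

text \<open>
  The point \<open>lim\<^sup>\<omega> (x\<^sub>n)\<close>. It depends only on the values of \<open>x\<close> on a set of \<open>\<omega>\<close>-measure 1, so
  \<open>x\<close> may be an arbitrary function that is an admissible sequence only up to an \<open>\<omega>\<close>-null
  set of indices.
\<close>

definition ulim_point ::
  "'i set \<Rightarrow> 'i filter \<Rightarrow> ('i \<Rightarrow> 'a metric) \<Rightarrow> ('i \<Rightarrow> 'a) \<Rightarrow> ('i \<Rightarrow> 'a) \<Rightarrow> ('i \<Rightarrow> 'a) set" where
  "ulim_point I \<omega> X e x = {y \<in> ulim_seqs I \<omega> X e. ulim_dist \<omega> X x y = 0}"

definition ulim ::
  "'i set \<Rightarrow> 'i filter \<Rightarrow> ('i \<Rightarrow> 'a metric) \<Rightarrow> ('i \<Rightarrow> 'a) \<Rightarrow> ('i \<Rightarrow> 'a) set metric" where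
  "ulim I \<omega> X e =
     metric (ulim_point I \<omega> X e ` ulim_seqs I \<omega> X e,
             \<lambda>C D. real_of_ereal (ulim_dist \<omega> X (SOME x. x \<in> C) (SOME y. y \<in> D)))"

definition scale_metric :: "real \<Rightarrow> 'a metric \<Rightarrow> 'a metric" where
  "scale_metric c X = metric (mspace X, \<lambda>x y. mdist X x y / c)"

definition asymptotic_cone ::
  "'i set \<Rightarrow> 'i filter \<Rightarrow> 'a metric \<Rightarrow> ('i \<Rightarrow> 'a) \<Rightarrow> ('i \<Rightarrow> real) \<Rightarrow> ('i \<Rightarrow> 'a) set metric" where
  "asymptotic_cone I \<omega> X e d = ulim I \<omega> (\<lambda>n. scale_metric (d n) X) e"

definition cone_seqs ::
  "'i set \<Rightarrow> 'i filter \<Rightarrow> 'a metric \<Rightarrow> ('i \<Rightarrow> 'a) \<Rightarrow> ('i \<Rightarrow> real) \<Rightarrow> ('i \<Rightarrow> 'a) set" where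
  "cone_seqs I \<omega> X e d = ulim_seqs I \<omega> (\<lambda>n. scale_metric (d n) X) e"

definition cone_point ::
  "'i set \<Rightarrow> 'i filter \<Rightarrow> 'a metric \<Rightarrow> ('i \<Rightarrow> 'a) \<Rightarrow> ('i \<Rightarrow> real) \<Rightarrow> ('i \<Rightarrow> 'a) \<Rightarrow> ('i \<Rightarrow> 'a) set" where
  "cone_point I \<omega> X e d x = ulim_point I \<omega> (\<lambda>n. scale_metric (d n) X) e x"

definition isometry_onto :: "'a metric \<Rightarrow> 'b metric \<Rightarrow> ('a \<Rightarrow> 'b) \<Rightarrow> bool" where
  "isometry_onto X Y f \<longleftrightarrow>
     f ` mspace X = mspace Y \<and>
     (\<forall>x\<in>mspace X. \<forall>y\<in>mspace X. mdist Y (f x) (f y) = mdist X x y)"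

text \<open>The type argument is the type from which the countable index set of the cone is drawn.\<close>

definition is_asymptotic_cone :: "'j itself \<Rightarrow> 'a metric \<Rightarrow> 'b metric \<Rightarrow> bool" where
  "is_asymptotic_cone T X Y \<longleftrightarrow>
     (\<exists>(J :: 'j set) \<nu> e d f.
        countable J \<and> ultrafilter_over J \<nu> \<and>
        (\<forall>j\<in>J. e j \<in> mspace X) \<and> (\<forall>j\<in>J. 0 < d j) \<and> filterlim d at_top \<nu> \<and>
        isometry_onto (asymptotic_cone J \<nu> X e d) Y f)"


section \<open>The constructions yield metric spaces\<close>

text \<open>
  The constructor \<^const>\<open>metric\<close> is only meaningful on genuine metric spaces; the following lemmas
  show that this is the case above and compute carrier and distance.
\<close>

lemma
  assumes "0 < c"
  shows mspace_scale_metric [simp]: "mspace (scale_metric c X) = mspace X"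
    and mdist_scale_metric [simp]: "mdist (scale_metric c X) x y = mdist X x y / c"
proof -
  interpret Metric_space "mspace X" "\<lambda>x y. mdist X x y / c"
  proof
    fix x y z assume "x \<in> mspace X" "y \<in> mspace X" "z \<in> mspace X"
    then show "mdist X x z / c \<le> mdist X x y / c + mdist X y z / c"
      using assms mdist_triangle[of x X y z] by (simp add: field_simps)
  qed (use assms in \<open>auto simp: mdist_commute\<close>)
  show "mspace (scale_metric c X) = mspace X" "mdist (scale_metric c X) x y = mdist X x y / c"
    by (simp_all add: scale_metric_def)
qed

context
  fixes I :: "'i set" and \<omega> :: "'i filter" and X :: "'i \<Rightarrow> 'a metric" and e :: "'i \<Rightarrow> 'a"
  assumes \<omega>: "ultrafilter_over I \<omega>"
begin

lemma ulim_dist_tendsto: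
  "((\<lambda>n. ereal (mdist (X n) (x n) (y n))) \<longlongrightarrow> ulim_dist \<omega> X x y) \<omega>"
proof -
  obtain l where l: "((\<lambda>n. ereal (mdist (X n) (x n) (y n))) \<longlongrightarrow> l) \<omega>"
    using ultrafilter_over_tendsto[OF \<omega> compact_UNIV] by blast
  then show ?thesis
    using tendsto_Lim[OF ultrafilter_over_nontrivial[OF \<omega>] l] by (simp add: ulim_dist_def)
qed

lemma ulim_dist_nonneg: "0 \<le> ulim_dist \<omega> X x y"
  by (rule tendsto_lowerbound[OF ulim_dist_tendsto _ ultrafilter_over_nontrivial[OF \<omega>]]) simp

lemma ulim_dist_commute: "ulim_dist \<omega> X x y = ulim_dist \<omega> X y x"
  by (simp add: ulim_dist_def mdist_commute)

lemma ulim_dist_triangle: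
  assumes "\<forall>n\<in>I. x n \<in> mspace (X n)" "\<forall>n\<in>I. y n \<in> mspace (X n)" "\<forall>n\<in>I. z n \<in> mspace (X n)"
  shows "ulim_dist \<omega> X x z \<le> ulim_dist \<omega> X x y + ulim_dist \<omega> X y z"
proof (rule tendsto_le[OF ultrafilter_over_nontrivial[OF \<omega>]])
  show "((\<lambda>n. ereal (mdist (X n) (x n) (y n)) + ereal (mdist (X n) (y n) (z n)))
          \<longlongrightarrow> ulim_dist \<omega> X x y + ulim_dist \<omega> X y z) \<omega>"
    using ulim_dist_nonneg[of x y] ulim_dist_nonneg[of y z]
    by (intro tendsto_add_ereal_nonneg ulim_dist_tendsto) auto
  show "((\<lambda>n. ereal (mdist (X n) (x n) (z n))) \<longlongrightarrow> ulim_dist \<omega> X x z) \<omega>"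
    by (rule ulim_dist_tendsto)
  have "\<forall>\<^sub>F n in \<omega>. n \<in> I"
    by (rule ultrafilter_over_index[OF \<omega>])
  then show "\<forall>\<^sub>F n in \<omega>. ereal (mdist (X n) (x n) (z n))
               \<le> ereal (mdist (X n) (x n) (y n)) + ereal (mdist (X n) (y n) (z n))"
    by (rule eventually_mono) (use assms in \<open>auto intro: mdist_triangle\<close>)
qed

lemma ulim_dist_self:
  assumes "\<forall>n\<in>I. x n \<in> mspace (X n)"
  shows "ulim_dist \<omega> X x x = 0"
proof -
  have "\<forall>\<^sub>F n in \<omega>. n \<in> I"
    by (rule ultrafilter_over_index[OF \<omega>])
  then have "((\<lambda>n. ereal (mdist (X n) (x n) (x n))) \<longlongrightarrow> 0) \<omega>"
    by (intro tendsto_eventually) (use assms in \<open>auto elim: eventually_mono\<close>)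
  then show ?thesis
    unfolding ulim_dist_def by (rule tendsto_Lim[OF ultrafilter_over_nontrivial[OF \<omega>]])
qed

lemma ulim_seqsD: "x \<in> ulim_seqs I \<omega> X e \<Longrightarrow> \<forall>n\<in>I. x n \<in> mspace (X n)"
  by (auto simp: ulim_seqs_def)

lemma ulim_point_self: "x \<in> ulim_seqs I \<omega> X e \<Longrightarrow> x \<in> ulim_point I \<omega> X e x"
  by (simp add: ulim_point_def ulim_dist_self[OF ulim_seqsD])

lemma ulim_dist_cong:
  assumes "x \<in> ulim_seqs I \<omega> X e" "y \<in> ulim_seqs I \<omega> X e"
    and "x' \<in> ulim_point I \<omega> X e x" "y' \<in> ulim_point I \<omega> X e y"
  shows "ulim_dist \<omega> X x' y' = ulim_dist \<omega> X x y"
proof -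
  have s: "x' \<in> ulim_seqs I \<omega> X e" "y' \<in> ulim_seqs I \<omega> X e"
    and 0: "ulim_dist \<omega> X x x' = 0" "ulim_dist \<omega> X y y' = 0"
    using assms by (auto simp: ulim_point_def)
  note S = assms(1,2)[THEN ulim_seqsD] s[THEN ulim_seqsD]
  have "ulim_dist \<omega> X x' y' \<le> ulim_dist \<omega> X x y"
    using ulim_dist_triangle[OF S(3,1,4)] ulim_dist_triangle[OF S(1,2,4)] 0
    by (simp add: ulim_dist_commute[of x' x])
  moreover have "ulim_dist \<omega> X x y \<le> ulim_dist \<omega> X x' y'"
    using ulim_dist_triangle[OF S(1,3,2)] ulim_dist_triangle[OF S(3,4,2)] 0
    by (simp add: ulim_dist_commute[of y' y])
  ultimately show ?thesis by simp
qed

lemma ulim_point_eq_iff: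
  assumes "x \<in> ulim_seqs I \<omega> X e" "y \<in> ulim_seqs I \<omega> X e"
  shows "ulim_point I \<omega> X e x = ulim_point I \<omega> X e y \<longleftrightarrow> ulim_dist \<omega> X x y = 0"
proof
  assume "ulim_point I \<omega> X e x = ulim_point I \<omega> X e y"
  then have "y \<in> ulim_point I \<omega> X e x"
    using ulim_point_self[OF assms(2)] by simp
  then show "ulim_dist \<omega> X x y = 0"
    by (simp add: ulim_point_def)
next
  assume 0: "ulim_dist \<omega> X x y = 0"
  have "ulim_dist \<omega> X x z = ulim_dist \<omega> X y z" if "z \<in> ulim_seqs I \<omega> X e" for z
    by (rule sym, rule ulim_dist_cong[OF assms(1) that _ ulim_point_self[OF that]])
       (simp add: ulim_point_def assms 0)
  then show "ulim_point I \<omega> X e x = ulim_point I \<omega> X e y"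
    by (auto simp: ulim_point_def)
qed

lemma ulim_dist_finite:
  assumes "\<forall>n\<in>I. e n \<in> mspace (X n)" "x \<in> ulim_seqs I \<omega> X e" "y \<in> ulim_seqs I \<omega> X e"
  shows "\<bar>ulim_dist \<omega> X x y\<bar> \<noteq> \<infinity>"
proof -
  have "ulim_dist \<omega> X x y \<le> ulim_dist \<omega> X x e + ulim_dist \<omega> X e y"
    by (rule ulim_dist_triangle[OF ulim_seqsD[OF assms(2)] assms(1) ulim_seqsD[OF assms(3)]])
  also have "\<dots> < \<infinity>"
    using assms(2,3) by (auto simp: ulim_seqs_def ulim_dist_commute[of e])
  finally show ?thesis
    using ulim_dist_nonneg[of x y] by auto
qed

lemma
  assumes e: "\<forall>n\<in>I. e n \<in> mspace (X n)"
  shows mspace_ulim: "mspace (ulim I \<omega> X e) = ulim_point I \<omega> X e ` ulim_seqs I \<omega> X e"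
    and mdist_ulim: "\<And>x y. x \<in> ulim_seqs I \<omega> X e \<Longrightarrow> y \<in> ulim_seqs I \<omega> X e \<Longrightarrow>
      mdist (ulim I \<omega> X e) (ulim_point I \<omega> X e x) (ulim_point I \<omega> X e y)
        = real_of_ereal (ulim_dist \<omega> X x y)"
proof -
  let ?S = "ulim_seqs I \<omega> X e" and ?p = "ulim_point I \<omega> X e"
  let ?d = "\<lambda>C D. real_of_ereal (ulim_dist \<omega> X (SOME x. x \<in> C) (SOME y. y \<in> D))"
  have d: "?d (?p x) (?p y) = real_of_ereal (ulim_dist \<omega> X x y)" if "x \<in> ?S" "y \<in> ?S" for x y
  proof -
    have "(SOME z. z \<in> ?p x) \<in> ?p x" "(SOME z. z \<in> ?p y) \<in> ?p y"
      by (rule someI[of "\<lambda>z. z \<in> ?p x", OF ulim_point_self[OF that(1)]],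
          rule someI[of "\<lambda>z. z \<in> ?p y", OF ulim_point_self[OF that(2)]])
    then show ?thesis
      using ulim_dist_cong[OF that] by simp
  qed
  interpret Metric_space "?p ` ?S" ?d
  proof
    show "0 \<le> ?d C D" "?d C D = ?d D C" for C D
      by (auto simp: real_of_ereal_pos ulim_dist_nonneg ulim_dist_commute)
  next
    fix C D assume "C \<in> ?p ` ?S" "D \<in> ?p ` ?S"
    then obtain x y where "x \<in> ?S" "C = ?p x" "y \<in> ?S" "D = ?p y" by blast
    then show "?d C D = 0 \<longleftrightarrow> C = D"
      using ulim_dist_finite[OF e, of x y] by (auto simp: d ulim_point_eq_iff real_of_ereal_eq_0)
  next
    fix C D E assume "C \<in> ?p ` ?S" "D \<in> ?p ` ?S" "E \<in> ?p ` ?S"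
    then obtain x y z where S: "x \<in> ?S" "y \<in> ?S" "z \<in> ?S" and eq: "C = ?p x" "D = ?p y" "E = ?p z"
      by blast
    have "ulim_dist \<omega> X x z \<le> ulim_dist \<omega> X x y + ulim_dist \<omega> X y z"
      using S by (intro ulim_dist_triangle ulim_seqsD)
    moreover obtain r s t where "ulim_dist \<omega> X x z = ereal r" "ulim_dist \<omega> X x y = ereal s"
        "ulim_dist \<omega> X y z = ereal t"
      using ulim_dist_finite[OF e S(1,3)] ulim_dist_finite[OF e S(1,2)] ulim_dist_finite[OF e S(2,3)]
      by (auto elim!: abs_neq_infinity_cases)
    ultimately show "?d C E \<le> ?d C D + ?d D E"
      by (simp add: eq d S)
  qed
  show "mspace (ulim I \<omega> X e) = ?p ` ?S"
    by (simp add: ulim_def)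
  show "mdist (ulim I \<omega> X e) (?p x) (?p y) = real_of_ereal (ulim_dist \<omega> X x y)"
    if "x \<in> ?S" "y \<in> ?S" for x y
    using d[OF that] by (simp add: ulim_def)
qed

end

end

theory Submission
  imports Defs
begin

text \<open>
  The theorem is not about scaling: for any family of pointed metric spaces \<open>Z n k\<close>, the limit
  along \<open>\<omega>\<mu>\<close> is the \<open>\<omega>\<close>-limit of the \<open>\<mu> n\<close>-limits. The reason is that a limit along
  \<open>\<omega>\<mu>\<close> is an iterated limit: first in \<open>k\<close> along \<open>\<mu> n\<close>, then in \<open>n\<close> along \<open>\<omega>\<close>
  (lemma \<open>prod_ultrafilter_tendsto_iterated\<close>). Applied to the distances, this says that passing
  from a sequence \<open>x\<close> over \<open>I \<times> J\<close> to the sequence of the classes of its slices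
  \<open>k \<mapsto> x (n, k)\<close> preserves distances (lemma \<open>ulim_dist_iterated\<close>); applied to the distance
  from the observation point, it says that \<open>\<omega>\<close>-almost all slices are admissible if \<open>x\<close> is.
  It is onto since representatives of the points of a sequence in the iterated limit, put
  side by side, form a sequence over \<open>I \<times> J\<close> which has them as its slices.

  The bookkeeping concerns null sets. An admissible \<open>x\<close> may have an \<open>\<omega>\<close>-null set of inadmissible
  slices, whose classes are empty and so are not points of the \<open>\<mu> n\<close>-limit. Replacing these by
  the observation points gives an honest sequence of points with the same
  \<open>\<omega>\<close>-limit. The cones are the case where \<open>Z n k\<close> is \<open>X\<close> with its metric divided by \<open>d n k\<close>;
  their iterated limit is again a cone because \<open>\<omega>\<mu>\<close> is a non-principal ultrafilter and
  \<open>d\<close> tends to infinity along it.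
\<close>

section \<open>Products of ultrafilters\<close>

lemma ultrafilter_over_prod:
  fixes \<omega> :: "'i filter" and \<mu> :: "'i \<Rightarrow> 'j filter"
  assumes \<omega>: "ultrafilter_over I \<omega>" and \<mu>: "\<forall>n\<in>I. ultrafilter_over J (\<mu> n)"
  shows "ultrafilter_over (I \<times> J) (prod_ultrafilter \<omega> \<mu>)"
proof -
  have I: "\<forall>\<^sub>F n in \<omega>. n \<in> I"
    by (rule ultrafilter_over_index[OF \<omega>])
  have const: "P n" if "n \<in> I" "\<forall>\<^sub>F k in \<mu> n. P n" for n P
    using that \<mu> ultrafilter_over_nontrivial[of J "\<mu> n"] by (auto simp: eventually_const)
  have index: "\<forall>\<^sub>F p in prod_ultrafilter \<omega> \<mu>. p \<in> I \<times> J"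
    unfolding eventually_prod_ultrafilter
    by (rule eventually_mono[OF I]) (use \<mu> ultrafilter_over_index in \<open>auto intro: eventually_conj\<close>)
  have nontrivial: "\<not> (\<forall>\<^sub>F p in prod_ultrafilter \<omega> \<mu>. False)"
  proof
    assume "\<forall>\<^sub>F p in prod_ultrafilter \<omega> \<mu>. False"
    then have "\<forall>\<^sub>F n in \<omega>. \<forall>\<^sub>F k in \<mu> n. False"
      by (simp only: eventually_prod_ultrafilter)
    with I have "\<forall>\<^sub>F n in \<omega>. False"
      by eventually_elim (rule const[where P = "\<lambda>_. False"])
    then show False
      using ultrafilter_over_nontrivial[OF \<omega>] by (simp add: eventually_const)
  qed
  have dichotomy: "(\<forall>\<^sub>F p in prod_ultrafilter \<omega> \<mu>. p \<in> A) \<or>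
      (\<forall>\<^sub>F p in prod_ultrafilter \<omega> \<mu>. p \<in> I \<times> J - A)" for A
  proof (cases "\<forall>\<^sub>F n in \<omega>. \<forall>\<^sub>F k in \<mu> n. (n, k) \<in> A")
    case True
    then show ?thesis by (simp add: eventually_prod_ultrafilter)
  next
    case False
    then have "\<forall>\<^sub>F n in \<omega>. \<not> (\<forall>\<^sub>F k in \<mu> n. (n, k) \<in> A)"
      using ultrafilter_over_dichotomy[OF \<omega>] by blast
    with I have "\<forall>\<^sub>F n in \<omega>. \<forall>\<^sub>F k in \<mu> n. (n, k) \<notin> A"
    proof eventually_elim
      case (elim n)
      then show ?case
        using \<mu> ultrafilter_over_dichotomy[of J "\<mu> n" "\<lambda>k. (n, k) \<in> A"] by blast
    qed
    then have "\<forall>\<^sub>F p in prod_ultrafilter \<omega> \<mu>. p \<notin> A"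
      by (simp add: eventually_prod_ultrafilter)
    with index have "\<forall>\<^sub>F p in prod_ultrafilter \<omega> \<mu>. p \<in> I \<times> J - A"
      by eventually_elim simp
    then show ?thesis ..
  qed
  have nonprincipal: "\<not> (\<forall>\<^sub>F p in prod_ultrafilter \<omega> \<mu>. p \<in> A)" if "finite A" for A
  proof
    assume "\<forall>\<^sub>F p in prod_ultrafilter \<omega> \<mu>. p \<in> A"
    then have "\<forall>\<^sub>F n in \<omega>. \<forall>\<^sub>F k in \<mu> n. (n, k) \<in> A"
      by (simp add: eventually_prod_ultrafilter)
    \<comment> \<open>A nonempty fibre over \<open>n\<close> puts \<open>n\<close> into the projection, a finite set.\<close>
    with I have "\<forall>\<^sub>F n in \<omega>. n \<in> fst ` A"
    proof eventually_elim
      case (elim n)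
      have "\<forall>\<^sub>F k in \<mu> n. n \<in> fst ` A"
        using elim(2) by eventually_elim force
      then show ?case
        using elim(1) by (intro const[where P = "\<lambda>n. n \<in> fst ` A"])
    qed
    moreover have "finite (fst ` A)"
      using that by simp
    ultimately show False
      using \<omega> unfolding ultrafilter_over_def by blast
  qed
  show ?thesis
    unfolding ultrafilter_over_def le_principal
    using index nontrivial dichotomy nonprincipal by (auto simp: trivial_limit_def)
qed

text \<open>
  A strict bound on \<open>f\<close> survives in the inner limits \<open>g n\<close> only as a weak inequality, so the
  proof interpolates a bound \<open>b\<close> between \<open>l\<close> and the given \<open>a\<close>.
\<close>

lemma prod_ultrafilter_tendsto_iterated:
  fixes f :: "'i \<times> 'j \<Rightarrow> 'b::linear_continuum_topology"
  assumes f: "(f \<longlongrightarrow> l) (prod_ultrafilter \<omega> \<mu>)"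
    and g: "\<forall>\<^sub>F n in \<omega>. \<mu> n \<noteq> bot \<and> ((\<lambda>k. f (n, k)) \<longlongrightarrow> g n) (\<mu> n)"
  shows "(g \<longlongrightarrow> l) \<omega>"
proof (rule order_tendstoI)
  fix a assume "a < l"
  then obtain b where b: "a < b" "b < l"
    using dense by blast
  from order_tendstoD(1)[OF f b(2)] have "\<forall>\<^sub>F n in \<omega>. \<forall>\<^sub>F k in \<mu> n. b < f (n, k)"
    by (simp add: eventually_prod_ultrafilter)
  with g show "\<forall>\<^sub>F n in \<omega>. a < g n"
  proof eventually_elim
    case (elim n)
    then have "b \<le> g n"
      by (intro tendsto_lowerbound[of "\<lambda>k. f (n, k)" "g n" "\<mu> n"]) (auto elim: eventually_mono)
    with b(1) show ?case by simp
  qed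
next
  fix a assume "l < a"
  then obtain b where b: "l < b" "b < a"
    using dense by blast
  from order_tendstoD(2)[OF f b(1)] have "\<forall>\<^sub>F n in \<omega>. \<forall>\<^sub>F k in \<mu> n. f (n, k) < b"
    by (simp add: eventually_prod_ultrafilter)
  with g show "\<forall>\<^sub>F n in \<omega>. g n < a"
  proof eventually_elim
    case (elim n)
    then have "g n \<le> b"
      by (intro tendsto_upperbound[of "\<lambda>k. f (n, k)" "g n" "\<mu> n"]) (auto elim: eventually_mono)
    with b(2) show ?case by simp
  qed
qed


section \<open>Ultralimits up to null sets, and maps between them\<close>

lemma ulim_dist_eventually_cong:
  assumes "\<forall>\<^sub>F n in \<omega>. x n = x' n \<and> y n = y' n"
  shows "ulim_dist \<omega> X x y = ulim_dist \<omega> X x' y'"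
proof -
  have "((\<lambda>n. ereal (mdist (X n) (x n) (y n))) \<longlongrightarrow> l) \<omega> \<longleftrightarrow>
      ((\<lambda>n. ereal (mdist (X n) (x' n) (y' n))) \<longlongrightarrow> l) \<omega>" for l
    by (rule tendsto_cong) (use assms in eventually_elim, simp)
  then show ?thesis
    by (simp add: ulim_dist_def t2_space_class.Lim_def)
qed

lemma ulim_point_eventually_cong:
  assumes "\<forall>\<^sub>F n in \<omega>. x n = x' n"
  shows "ulim_point I \<omega> X e x = ulim_point I \<omega> X e x'"
proof -
  have "ulim_dist \<omega> X x y = ulim_dist \<omega> X x' y" for y
    by (rule ulim_dist_eventually_cong) (use assms in simp)
  then show ?thesis
    by (simp add: ulim_point_def)
qed

text \<open>
  A map of admissible sequences that preserves distances respects the relation of being at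
  distance \<open>0\<close>, so it descends to the points.
\<close>

lemma isometry_onto_ulim_if_seqs:
  assumes \<omega>: "ultrafilter_over I \<omega>" and \<nu>: "ultrafilter_over J \<nu>"
    and e: "\<forall>n\<in>I. e n \<in> mspace (X n)" and c: "\<forall>n\<in>J. c n \<in> mspace (Y n)"
    and onto: "F ` ulim_seqs I \<omega> X e = ulim_seqs J \<nu> Y c"
    and dist: "\<And>x y. x \<in> ulim_seqs I \<omega> X e \<Longrightarrow> y \<in> ulim_seqs I \<omega> X e \<Longrightarrow>
      ulim_dist \<nu> Y (F x) (F y) = ulim_dist \<omega> X x y"
  obtains \<Phi> where "isometry_onto (ulim I \<omega> X e) (ulim J \<nu> Y c) \<Phi>"
    and "\<And>x. x \<in> ulim_seqs I \<omega> X e \<Longrightarrow> \<Phi> (ulim_point I \<omega> X e x) = ulim_point J \<nu> Y c (F x)"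
proof -
  let ?S = "ulim_seqs I \<omega> X e" and ?p = "ulim_point I \<omega> X e" and ?q = "ulim_point J \<nu> Y c"
  define \<Phi> where "\<Phi> C = ?q (F (SOME x. x \<in> C))" for C
  have F: "F x \<in> ulim_seqs J \<nu> Y c" if "x \<in> ?S" for x
    using onto that by blast
  have \<Phi>: "\<Phi> (?p x) = ?q (F x)" if x: "x \<in> ?S" for x
  proof -
    let ?z = "SOME z. z \<in> ?p x"
    have "?z \<in> ?p x"
      by (rule someI[of "\<lambda>z. z \<in> ?p x", OF ulim_point_self[OF \<omega> x]])
    then have z: "?z \<in> ?S" "ulim_dist \<omega> X x ?z = 0"
      by (simp_all add: ulim_point_def)
    then have "ulim_dist \<nu> Y (F x) (F ?z) = 0"
      using dist[OF x z(1)] by simp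
    then show ?thesis
      using ulim_point_eq_iff[OF \<nu> F[OF x] F[OF z(1)]] by (simp add: \<Phi>_def)
  qed
  have "\<Phi> ` ?p ` ?S = ?q ` F ` ?S"
    by (simp add: image_image \<Phi>)
  then have "isometry_onto (ulim I \<omega> X e) (ulim J \<nu> Y c) \<Phi>"
    by (auto simp: isometry_onto_def mspace_ulim[OF \<omega> e] mspace_ulim[OF \<nu> c] onto
        mdist_ulim[OF \<omega> e] mdist_ulim[OF \<nu> c] \<Phi> F dist)
  then show ?thesis
    using \<Phi> that by blast
qed


section \<open>Iterated ultralimits\<close>

context
  fixes I :: "'i set" and J :: "'j set" and \<omega> :: "'i filter" and \<mu> :: "'i \<Rightarrow> 'j filter"
    and Z :: "'i \<Rightarrow> 'j \<Rightarrow> 'a metric" and e :: "'i \<Rightarrow> 'j \<Rightarrow> 'a"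
  assumes \<omega>: "ultrafilter_over I \<omega>" and \<mu>: "\<forall>n\<in>I. ultrafilter_over J (\<mu> n)"
    and e: "\<forall>n\<in>I. \<forall>k\<in>J. e n k \<in> mspace (Z n k)"
begin

abbreviation inner_seqs :: "'i \<Rightarrow> ('j \<Rightarrow> 'a) set" where
  "inner_seqs n \<equiv> ulim_seqs J (\<mu> n) (Z n) (e n)"

abbreviation inner_point :: "'i \<Rightarrow> ('j \<Rightarrow> 'a) \<Rightarrow> ('j \<Rightarrow> 'a) set" where
  "inner_point n \<equiv> ulim_point J (\<mu> n) (Z n) (e n)"

abbreviation inner_ulim :: "'i \<Rightarrow> ('j \<Rightarrow> 'a) set metric" where
  "inner_ulim n \<equiv> ulim J (\<mu> n) (Z n) (e n)"

abbreviation (input) slice :: "('i \<times> 'j \<Rightarrow> 'a) \<Rightarrow> 'i \<Rightarrow> 'j \<Rightarrow> 'a" where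
  "slice x n \<equiv> (\<lambda>k\<in>J. x (n, k))"

lemma inner_ulim_dist_slice:
  assumes "n \<in> I"
  shows "ulim_dist (\<mu> n) (Z n) (slice x n) (slice y n)
    = ulim_dist (\<mu> n) (Z n) (\<lambda>k. x (n, k)) (\<lambda>k. y (n, k))"
  by (rule ulim_dist_eventually_cong)
     (use \<mu> assms ultrafilter_over_index[of J "\<mu> n"] in \<open>auto elim: eventually_mono\<close>)

lemma tendsto_inner_ulim_dist_slice:
  "((\<lambda>n. ulim_dist (\<mu> n) (Z n) (slice x n) (slice y n))
     \<longlongrightarrow> ulim_dist (prod_ultrafilter \<omega> \<mu>) (\<lambda>(n, k). Z n k) x y) \<omega>"
proof (rule prod_ultrafilter_tendsto_iterated)
  show "((\<lambda>p. ereal (mdist ((\<lambda>(n, k). Z n k) p) (x p) (y p)))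
     \<longlongrightarrow> ulim_dist (prod_ultrafilter \<omega> \<mu>) (\<lambda>(n, k). Z n k) x y) (prod_ultrafilter \<omega> \<mu>)"
    by (rule ulim_dist_tendsto[OF ultrafilter_over_prod[OF \<omega> \<mu>]])
  show "\<forall>\<^sub>F n in \<omega>. \<mu> n \<noteq> bot \<and>
      ((\<lambda>k. ereal (mdist ((\<lambda>(n, k). Z n k) (n, k)) (x (n, k)) (y (n, k))))
        \<longlongrightarrow> ulim_dist (\<mu> n) (Z n) (slice x n) (slice y n)) (\<mu> n)"
    using ultrafilter_over_index[OF \<omega>]
  proof eventually_elim
    case (elim n)
    then have "ultrafilter_over J (\<mu> n)"
      using \<mu> by blast
    then show ?case
      using ulim_dist_tendsto[of J "\<mu> n" "Z n" "\<lambda>k. x (n, k)" "\<lambda>k. y (n, k)"]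
      by (simp add: inner_ulim_dist_slice[OF elim] ultrafilter_over_nontrivial)
  qed
qed

text \<open>
  \<open>e n\<close> may take arbitrary values outside \<open>J\<close>, and then it is not an admissible sequence in
  the strict sense; its restriction to \<open>J\<close> is one, and has the same class.
\<close>

lemma slice_base_in_inner_seqs:
  assumes n: "n \<in> I"
  shows "slice (\<lambda>(n, k). e n k) n \<in> inner_seqs n"
    and "inner_point n (slice (\<lambda>(n, k). e n k) n) = inner_point n (e n)"
proof -
  have \<mu>n: "ultrafilter_over J (\<mu> n)"
    using \<mu> n by blast
  have ev: "\<forall>\<^sub>F k in \<mu> n. slice (\<lambda>(n, k). e n k) n k = e n k"
    by (rule eventually_mono[OF ultrafilter_over_index[OF \<mu>n]]) simp
  have "ulim_dist (\<mu> n) (Z n) (slice (\<lambda>(n, k). e n k) n) (e n) = ulim_dist (\<mu> n) (Z n) (e n) (e n)"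
    by (rule ulim_dist_eventually_cong) (use ev in simp)
  also have "\<dots> = 0"
    by (rule ulim_dist_self[OF \<mu>n]) (use e n in blast)
  finally show "slice (\<lambda>(n, k). e n k) n \<in> inner_seqs n"
    using e n by (simp add: ulim_seqs_def)
  show "inner_point n (slice (\<lambda>(n, k). e n k) n) = inner_point n (e n)"
    by (rule ulim_point_eventually_cong[OF ev])
qed

lemma inner_base_in_mspace: "\<forall>n\<in>I. inner_point n (e n) \<in> mspace (inner_ulim n)"
proof
  fix n assume n: "n \<in> I"
  show "inner_point n (e n) \<in> mspace (inner_ulim n)"
    using \<mu> e n mspace_ulim[of J "\<mu> n" "e n" "Z n"] slice_base_in_inner_seqs[OF n]
    by (metis imageI)
qed

lemma eventually_slice_in_inner_seqs:
  assumes x: "x \<in> ulim_seqs (I \<times> J) (prod_ultrafilter \<omega> \<mu>) (\<lambda>(n, k). Z n k) (\<lambda>(n, k). e n k)"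
  shows "\<forall>\<^sub>F n in \<omega>. slice x n \<in> inner_seqs n"
proof -
  have "\<forall>\<^sub>F n in \<omega>. ulim_dist (\<mu> n) (Z n) (slice x n) (slice (\<lambda>(n, k). e n k) n) < \<infinity>"
    by (rule order_tendstoD(2)[OF tendsto_inner_ulim_dist_slice])
       (use x in \<open>simp add: ulim_seqs_def\<close>)
  with ultrafilter_over_index[OF \<omega>] show ?thesis
  proof eventually_elim
    case (elim n)
    have "ulim_dist (\<mu> n) (Z n) (slice x n) (slice (\<lambda>(n, k). e n k) n)
      = ulim_dist (\<mu> n) (Z n) (slice x n) (e n)"
      by (rule ulim_dist_eventually_cong)
         (use \<mu> elim(1) ultrafilter_over_index[of J "\<mu> n"] in \<open>auto elim: eventually_mono\<close>)
    moreover have "\<forall>k\<in>J. x (n, k) \<in> mspace (Z n k)"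
      using ulim_seqsD[OF ultrafilter_over_prod[OF \<omega> \<mu>] x] elim(1) by auto
    ultimately show ?case
      using elim(2) by (simp add: ulim_seqs_def)
  qed
qed

text \<open>
  Between admissible slices the extended real limit distance is finite and hence equals the
  distance of their classes; so the iterated limit applies. The hypotheses are about the slices
  rather than \<open>x\<close> and \<open>y\<close> because the lemma also has to show, with the observation point as
  \<open>y\<close>, that a family \<open>x\<close> assembled from admissible slices is itself admissible.
\<close>

lemma ulim_dist_iterated:
  assumes x: "\<forall>\<^sub>F n in \<omega>. slice x n \<in> inner_seqs n" and y: "\<forall>\<^sub>F n in \<omega>. slice y n \<in> inner_seqs n"
  shows "ulim_dist \<omega> inner_ulim (\<lambda>n. inner_point n (slice x n)) (\<lambda>n. inner_point n (slice y n))
    = ulim_dist (prod_ultrafilter \<omega> \<mu>) (\<lambda>(n, k). Z n k) x y"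
proof -
  have "\<forall>\<^sub>F n in \<omega>.
      ereal (mdist (inner_ulim n) (inner_point n (slice x n)) (inner_point n (slice y n)))
      = ulim_dist (\<mu> n) (Z n) (slice x n) (slice y n)"
    using ultrafilter_over_index[OF \<omega>] x y
  proof eventually_elim
    case (elim n)
    have \<mu>n: "ultrafilter_over J (\<mu> n)" and en: "\<forall>k\<in>J. e n k \<in> mspace (Z n k)"
      using \<mu> e elim(1) by blast+
    show ?case
      using ulim_dist_finite[OF \<mu>n en elim(2,3)]
      by (simp add: mdist_ulim[OF \<mu>n en elim(2,3)] ereal_real')
  qed
  then have "((\<lambda>n. ereal (mdist (inner_ulim n) (inner_point n (slice x n)) (inner_point n (slice y n))))
      \<longlongrightarrow> ulim_dist (prod_ultrafilter \<omega> \<mu>) (\<lambda>(n, k). Z n k) x y) \<omega>"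
    using tendsto_inner_ulim_dist_slice[of x y] by (simp add: tendsto_cong)
  then show ?thesis
    unfolding ulim_dist_def[of \<omega>] by (rule tendsto_Lim[OF ultrafilter_over_nontrivial[OF \<omega>]])
qed

text \<open>
  With the observation point in place of the inadmissible slices, the sequence of classes
  consists of points of the inner limits for every \<open>n\<close>, not only for almost every \<open>n\<close>.
\<close>

definition slice_points :: "('i \<times> 'j \<Rightarrow> 'a) \<Rightarrow> 'i \<Rightarrow> ('j \<Rightarrow> 'a) set" where
  "slice_points x =
     (\<lambda>n\<in>I. if slice x n \<in> inner_seqs n then inner_point n (slice x n) else inner_point n (e n))"

lemma eventually_slice_points:
  assumes "\<forall>\<^sub>F n in \<omega>. slice x n \<in> inner_seqs n"
  shows "\<forall>\<^sub>F n in \<omega>. slice_points x n = inner_point n (slice x n)"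
  using ultrafilter_over_index[OF \<omega>] assms by eventually_elim (simp add: slice_points_def)

lemma ulim_dist_slice_points:
  assumes "\<forall>\<^sub>F n in \<omega>. slice x n \<in> inner_seqs n" "\<forall>\<^sub>F n in \<omega>. slice y n \<in> inner_seqs n"
  shows "ulim_dist \<omega> inner_ulim (slice_points x) (slice_points y)
    = ulim_dist (prod_ultrafilter \<omega> \<mu>) (\<lambda>(n, k). Z n k) x y"
  unfolding ulim_dist_iterated[OF assms, symmetric]
  by (rule ulim_dist_eventually_cong) (intro eventually_conj eventually_slice_points assms)

lemma ulim_dist_slice_points_base:
  assumes "\<forall>\<^sub>F n in \<omega>. slice x n \<in> inner_seqs n"
  shows "ulim_dist \<omega> inner_ulim (slice_points x) (\<lambda>n. inner_point n (e n))
    = ulim_dist (prod_ultrafilter \<omega> \<mu>) (\<lambda>(n, k). Z n k) x (\<lambda>(n, k). e n k)"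
proof -
  note I = ultrafilter_over_index[OF \<omega>]
  have "\<forall>\<^sub>F n in \<omega>. slice (\<lambda>(n, k). e n k) n \<in> inner_seqs n"
    by (rule eventually_mono[OF I slice_base_in_inner_seqs(1)])
  note ulim_dist_iterated[OF assms this, symmetric]
  also have "ulim_dist \<omega> inner_ulim (\<lambda>n. inner_point n (slice x n))
      (\<lambda>n. inner_point n (slice (\<lambda>(n, k). e n k) n))
    = ulim_dist \<omega> inner_ulim (slice_points x) (\<lambda>n. inner_point n (e n))"
    by (rule ulim_dist_eventually_cong)
       (use I eventually_slice_points[OF assms] in
         \<open>eventually_elim, simp only: slice_base_in_inner_seqs(2) simp_thms\<close>)
  finally show ?thesis by simp
qed

lemma slice_points_image:
  "slice_points ` ulim_seqs (I \<times> J) (prod_ultrafilter \<omega> \<mu>) (\<lambda>(n, k). Z n k) (\<lambda>(n, k). e n k)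
    = ulim_seqs I \<omega> inner_ulim (\<lambda>n. inner_point n (e n))"
  (is "_ ` ?S = ?T")
proof
  have mspace: "mspace (inner_ulim n) = inner_point n ` inner_seqs n" if "n \<in> I" for n
    using \<mu> e that by (intro mspace_ulim) auto
  show "slice_points ` ?S \<subseteq> ?T"
  proof (rule image_subsetI)
    fix x assume x: "x \<in> ?S"
    have "ulim_dist \<omega> inner_ulim (slice_points x) (\<lambda>n. inner_point n (e n)) < \<infinity>"
      using ulim_dist_slice_points_base[OF eventually_slice_in_inner_seqs[OF x]] x
      by (simp add: ulim_seqs_def)
    moreover have "slice_points x \<in> (\<Pi>\<^sub>E n\<in>I. mspace (inner_ulim n))"
    proof (rule PiE_I)
      fix n assume n: "n \<in> I"
      show "slice_points x n \<in> mspace (inner_ulim n)"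
        using n inner_base_in_mspace mspace[OF n] by (auto simp: slice_points_def)
    qed (simp add: slice_points_def)
    ultimately show "slice_points x \<in> ?T"
      by (simp add: ulim_seqs_def)
  qed
  show "?T \<subseteq> slice_points ` ?S"
  proof
    fix t assume t: "t \<in> ?T"
    have "t n \<in> mspace (inner_ulim n)" if "n \<in> I" for n
      using ulim_seqsD[OF \<omega> t] that by blast
    then have "\<forall>n\<in>I. \<exists>y. y \<in> inner_seqs n \<and> t n = inner_point n y"
      using mspace by blast
    then obtain y where y: "\<And>n. n \<in> I \<Longrightarrow> y n \<in> inner_seqs n \<and> t n = inner_point n (y n)"
      by metis
    define x where "x = (\<lambda>(n, k)\<in>I \<times> J. y n k)"
    have slice: "slice x n = y n" if n: "n \<in> I" for n
    proof -
      have "slice x n = restrict (y n) J"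
        using n by (auto simp: x_def)
      also have "\<dots> = y n"
        using y[OF n] by (auto simp: ulim_seqs_def intro: extensional_restrict)
      finally show ?thesis .
    qed
    have "t \<in> extensional I"
      using t by (simp add: ulim_seqs_def PiE_def)
    then have eq: "slice_points x = t"
      by (intro extensionalityI[of _ I]) (simp_all add: slice_points_def slice y)
    have "\<forall>\<^sub>F n in \<omega>. slice x n \<in> inner_seqs n"
      by (rule eventually_mono[OF ultrafilter_over_index[OF \<omega>]]) (simp add: slice y)
    then have "ulim_dist (prod_ultrafilter \<omega> \<mu>) (\<lambda>(n, k). Z n k) x (\<lambda>(n, k). e n k) < \<infinity>"
      using ulim_dist_slice_points_base[of x] t by (simp add: eq ulim_seqs_def)
    moreover have "y n k \<in> mspace (Z n k)" if "n \<in> I" "k \<in> J" for n k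
      using y[OF that(1)] that(2) by (auto simp: ulim_seqs_def)
    then have "x \<in> (\<Pi>\<^sub>E p\<in>I \<times> J. mspace ((\<lambda>(n, k). Z n k) p))"
      unfolding x_def by (intro restrict_PiE_iff[THEN iffD2]) auto
    ultimately have "x \<in> ?S"
      by (simp add: ulim_seqs_def)
    with eq show "t \<in> slice_points ` ?S" by blast
  qed
qed

theorem isometry_onto_iterated_ulim:
  obtains \<Phi> where
    "isometry_onto (ulim (I \<times> J) (prod_ultrafilter \<omega> \<mu>) (\<lambda>(n, k). Z n k) (\<lambda>(n, k). e n k))
       (ulim I \<omega> inner_ulim (\<lambda>n. inner_point n (e n))) \<Phi>"
    and "\<And>x. x \<in> ulim_seqs (I \<times> J) (prod_ultrafilter \<omega> \<mu>) (\<lambda>(n, k). Z n k) (\<lambda>(n, k). e n k) \<Longrightarrow>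
       \<Phi> (ulim_point (I \<times> J) (prod_ultrafilter \<omega> \<mu>) (\<lambda>(n, k). Z n k) (\<lambda>(n, k). e n k) x)
       = ulim_point I \<omega> inner_ulim (\<lambda>n. inner_point n (e n)) (\<lambda>n. inner_point n (slice x n))"
proof -
  let ?S = "ulim_seqs (I \<times> J) (prod_ultrafilter \<omega> \<mu>) (\<lambda>(n, k). Z n k) (\<lambda>(n, k). e n k)"
  have e': "\<forall>p\<in>I \<times> J. (\<lambda>(n, k). e n k) p \<in> mspace ((\<lambda>(n, k). Z n k) p)"
    using e by auto
  have dist: "ulim_dist \<omega> inner_ulim (slice_points x) (slice_points y)
      = ulim_dist (prod_ultrafilter \<omega> \<mu>) (\<lambda>(n, k). Z n k) x y" if "x \<in> ?S" "y \<in> ?S" for x y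
    by (intro ulim_dist_slice_points eventually_slice_in_inner_seqs that)
  have point: "ulim_point I \<omega> inner_ulim (\<lambda>n. inner_point n (e n)) (slice_points x)
      = ulim_point I \<omega> inner_ulim (\<lambda>n. inner_point n (e n)) (\<lambda>n. inner_point n (slice x n))"
    if "x \<in> ?S" for x
    by (intro ulim_point_eventually_cong eventually_slice_points eventually_slice_in_inner_seqs that)
  show ?thesis
  proof (rule isometry_onto_ulim_if_seqs[OF ultrafilter_over_prod[OF \<omega> \<mu>] \<omega> e'
        inner_base_in_mspace slice_points_image dist])
    fix \<Phi>
    assume "isometry_onto (ulim (I \<times> J) (prod_ultrafilter \<omega> \<mu>) (\<lambda>(n, k). Z n k) (\<lambda>(n, k). e n k))
        (ulim I \<omega> inner_ulim (\<lambda>n. inner_point n (e n))) \<Phi>"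
      and "\<And>x. x \<in> ?S \<Longrightarrow>
        \<Phi> (ulim_point (I \<times> J) (prod_ultrafilter \<omega> \<mu>) (\<lambda>(n, k). Z n k) (\<lambda>(n, k). e n k) x)
        = ulim_point I \<omega> inner_ulim (\<lambda>n. inner_point n (e n)) (slice_points x)"
    then show ?thesis
      by (intro that[of \<Phi>]) (simp_all only: point)
  qed
qed

end


section \<open>Iterated asymptotic cones\<close>

lemma filterlim_prod_ultrafilter_at_top:
  fixes d :: "'i \<Rightarrow> 'j \<Rightarrow> 'b::linorder"
  assumes "\<forall>\<^sub>F n in \<omega>. filterlim (d n) at_top (\<mu> n)"
  shows "filterlim (\<lambda>(n, k). d n k) at_top (prod_ultrafilter \<omega> \<mu>)"
  unfolding filterlim_at_top eventually_prod_ultrafilter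
  using assms by (auto simp: filterlim_at_top elim: eventually_mono)

theorem corollary3p24:
  fixes X :: "'a metric" and I :: "'i set"
    and \<omega> :: "'i filter" and \<mu> :: "'i \<Rightarrow> 'i filter"
    and e :: "'i \<Rightarrow> 'i \<Rightarrow> 'a" and d :: "'i \<Rightarrow> 'i \<Rightarrow> real"
  assumes "countable I"
    and "ultrafilter_over I \<omega>"
    and "\<forall>n\<in>I. ultrafilter_over I (\<mu> n)"
    and "\<forall>n\<in>I. \<forall>k\<in>I. e n k \<in> mspace X"
    and "\<forall>n\<in>I. \<forall>k\<in>I. 0 < d n k"
    and "\<forall>n\<in>I. filterlim (d n) at_top (\<mu> n)"
  defines "\<omega>\<mu> \<equiv> prod_ultrafilter \<omega> \<mu>"
    and "ee \<equiv> (\<lambda>(n, k). e n k)" and "dd \<equiv> (\<lambda>(n, k). d n k)"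
  defines "L \<equiv> ulim I \<omega> (\<lambda>n. asymptotic_cone I (\<mu> n) X (e n) (d n))
                  (\<lambda>n. cone_point I (\<mu> n) X (e n) (d n) (e n))"
  shows "ultrafilter_over (I \<times> I) \<omega>\<mu> \<and> filterlim dd at_top \<omega>\<mu> \<and>
    (\<exists>\<Phi>. isometry_onto (asymptotic_cone (I \<times> I) \<omega>\<mu> X ee dd) L \<Phi> \<and>
      (\<forall>x \<in> cone_seqs (I \<times> I) \<omega>\<mu> X ee dd.
        (\<forall>\<^sub>F n in \<omega>. (\<lambda>k\<in>I. x (n, k)) \<in> cone_seqs I (\<mu> n) X (e n) (d n)) \<and>
        \<Phi> (cone_point (I \<times> I) \<omega>\<mu> X ee dd x) =
          ulim_point I \<omega> (\<lambda>n. asymptotic_cone I (\<mu> n) X (e n) (d n))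
            (\<lambda>n. cone_point I (\<mu> n) X (e n) (d n) (e n))
            (\<lambda>n. cone_point I (\<mu> n) X (e n) (d n) (\<lambda>k\<in>I. x (n, k))))) \<and>
    is_asymptotic_cone TYPE('i \<times> 'i) X L"
proof -
  let ?Z = "\<lambda>n k. scale_metric (d n k) X"
  have Z: "(\<lambda>p. scale_metric (dd p) X) = (\<lambda>(n, k). ?Z n k)"
    by (auto simp: dd_def)
  have e: "\<forall>n\<in>I. \<forall>k\<in>I. e n k \<in> mspace (?Z n k)"
    using assms(4,5) by simp
  note iterated = assms(2,3) e
  note unfold = asymptotic_cone_def cone_seqs_def cone_point_def Z \<omega>\<mu>_def ee_def L_def
  have ultra: "ultrafilter_over (I \<times> I) \<omega>\<mu>"
    unfolding \<omega>\<mu>_def by (rule ultrafilter_over_prod[OF assms(2,3)])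
  have lim: "filterlim dd at_top \<omega>\<mu>"
    unfolding \<omega>\<mu>_def dd_def
    by (intro filterlim_prod_ultrafilter_at_top eventually_mono[OF ultrafilter_over_index[OF assms(2)]])
       (use assms(6) in blast)
  have slices: "\<forall>\<^sub>F n in \<omega>. (\<lambda>k\<in>I. x (n, k)) \<in> cone_seqs I (\<mu> n) X (e n) (d n)"
    if "x \<in> cone_seqs (I \<times> I) \<omega>\<mu> X ee dd" for x
    using eventually_slice_in_inner_seqs[OF iterated] that unfolding unfold by blast
  obtain \<Phi> where iso: "isometry_onto (asymptotic_cone (I \<times> I) \<omega>\<mu> X ee dd) L \<Phi>"
    and \<Phi>: "\<And>x. x \<in> cone_seqs (I \<times> I) \<omega>\<mu> X ee dd \<Longrightarrow>
      \<Phi> (cone_point (I \<times> I) \<omega>\<mu> X ee dd x) =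
        ulim_point I \<omega> (\<lambda>n. asymptotic_cone I (\<mu> n) X (e n) (d n))
          (\<lambda>n. cone_point I (\<mu> n) X (e n) (d n) (e n))
          (\<lambda>n. cone_point I (\<mu> n) X (e n) (d n) (\<lambda>k\<in>I. x (n, k)))"
    using isometry_onto_iterated_ulim[OF iterated] unfolding unfold by blast
  have "countable (I \<times> I)" "\<forall>j\<in>I \<times> I. ee j \<in> mspace X" "\<forall>j\<in>I \<times> I. 0 < dd j"
    using assms(1,4,5) by (auto simp: ee_def dd_def)
  with ultra lim iso have "is_asymptotic_cone TYPE('i \<times> 'i) X L"
    unfolding is_asymptotic_cone_def by blast
  with ultra lim iso slices \<Phi> show ?thesis
    by blast
qed

end
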